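(* Let $(S,* )$ be an adequate partial semigroup which has property (†), i.e. for every $k\in\mathbb{N}$ and every $L\in\mathcal{P}_f(S)$ there exists $r\in\mathbb{N}$ such that for every $F\in\mathcal{P}_f(\mathcal{T})_{\leq k}$ there exists $t\in\{1,\dots,r\}$ with $f(t)\in\sigma(L)$ for all $f\in F$. Then $S$ is a CR set in $S$.
   Context: A partial semigroup is a pair $(S,* )$ where $S$ is a nonempty set and $*$ is an operation defined on a nonempty subset of $S\times S$ such that for all $x,y,z\in S$, $(x*y)*z=x*(y*z)$ in the sense that if either side is defined then so is the other and they are equal. For $a\in S$, $\varphi(a)=\{b\in S: a*b \text{ is defined}\}$; for finite nonempty $F\subseteq S$, $\sigma(F)=\bigcap_{a\in F}\varphi(a)$. $(S,* )$ is adequate if $\sigma(F)\neq\emptyset$ for all finite nonempty $F$. $\mathcal{P}_f(X)$ denotes the set of finite nonempty subsets of $X$. Products $\prod_{t\in H}f(t)$ are computed in increasing order of indices. A sequence $f:\mathbb{N}\to S$ is adequate if (i) for each $H\in\mathcal{P}_f(\mathbb{N})$, $\prod_{t\in H}f(t)$ is defined, and (ii) for each $F\in\mathcal{P}_f(S)$ there is $m\in\mathbb{N}$ such that $\prod_{t\in H}f(t)\in\sigma(F)$ for all $H\in\mathcal{P}_f(\mathbb{N})$ with $\min H\geq m$. $\mathcal{T}$ denotes the set of adequate sequences, and $\mathcal{P}_f(\mathcal{T})_{\leq k}=\{F\in\mathcal{P}_f(\mathcal{T}): |F|\leq k\}$. For $k\in\mathbb{N}$, $A\subseteq S$ is a $k$-CR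 set if for every $L\in\mathcal{P}_f(S)$ there is $r\in\mathbb{N}$ such that for every $F\in\mathcal{P}_f(\mathcal{T})_{\leq k}$ there exist $m\in\mathbb{N}$, $a\in S^{m+1}$ and $t(1)<\dots<t(m)\leq r$ in $\mathbb{N}$ such that for all $f\in F$, $a(1)*f(t(1))*a(2)*\dots*a(m)*f(t(m))*a(m+1)$ is defined and lies in $A\cap\sigma(L)$. $A$ is a CR set if it is a $k$-CR set for every $k\in\mathbb{N}$. *)

theory Defs
  imports Main "HOL-Library.FuncSet"
begin

text \<open>
  A partial binary operation on a carrier set is a function \<open>mul :: 'a \<Rightarrow> 'a \<Rightarrow> 'a option\<close>,
  where \<open>None\<close> means ``undefined''. Throughout, the natural numbers start at 1:
  sequences have index set \<open>{1..}\<close>, and are extensional (\<open>\<rightarrow>\<^sub>E\<close>), so that equality of sequences,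
  and hence the cardinality of a set of sequences, ignores the type's additional element 0.
\<close>

text \<open>Strictness of \<open>Option.bind\<close> makes the last conjunct say that if either side of the
  associative law is defined, then so is the other and they are equal.\<close>

definition partial_semigroup :: "'a set \<Rightarrow> ('a \<Rightarrow> 'a \<Rightarrow> 'a option) \<Rightarrow> bool" where
  "partial_semigroup S mul \<longleftrightarrow>
     S \<noteq> {} \<and>
     (\<exists>x y. mul x y \<noteq> None) \<and>
     (\<forall>x y z. mul x y = Some z \<longrightarrow> x \<in> S \<and> y \<in> S \<and> z \<in> S) \<and>
     (\<forall>x\<in>S. \<forall>y\<in>S. \<forall>z\<in>S.
        Option.bind (mul x y) (\<lambda>u. mul u z) = Option.bind (mul y z) (\<lambda>v. mul x v))"

definition fin_subsets :: "'a set \<Rightarrow> 'a set set" where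
  "fin_subsets X = {F. F \<subseteq> X \<and> finite F \<and> F \<noteq> {}}"

definition fin_subsets_le :: "'a set \<Rightarrow> nat \<Rightarrow> 'a set set" where
  "fin_subsets_le X k = {F \<in> fin_subsets X. card F \<le> k}"

definition phi :: "'a set \<Rightarrow> ('a \<Rightarrow> 'a \<Rightarrow> 'a option) \<Rightarrow> 'a \<Rightarrow> 'a set" where
  "phi S mul a = {b \<in> S. mul a b \<noteq> None}"

definition sigma :: "'a set \<Rightarrow> ('a \<Rightarrow> 'a \<Rightarrow> 'a option) \<Rightarrow> 'a set \<Rightarrow> 'a set" where
  "sigma S mul F = (\<Inter>a\<in>F. phi S mul a)"

definition adequate :: "'a set \<Rightarrow> ('a \<Rightarrow> 'a \<Rightarrow> 'a option) \<Rightarrow> bool" where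
  "adequate S mul \<longleftrightarrow> (\<forall>F \<in> fin_subsets S. sigma S mul F \<noteq> {})"

text \<open>The product of a list, bracketed to the left; by associativity the bracketing is immaterial.
  The empty product is undefined, as there need not be a unit.\<close>

fun list_product :: "('a \<Rightarrow> 'a \<Rightarrow> 'a option) \<Rightarrow> 'a list \<Rightarrow> 'a option" where
  "list_product mul [] = None"
| "list_product mul [x] = Some x"
| "list_product mul (x # y # zs) = Option.bind (mul x y) (\<lambda>u. list_product mul (u # zs))"

definition set_product :: "('a \<Rightarrow> 'a \<Rightarrow> 'a option) \<Rightarrow> (nat \<Rightarrow> 'a) \<Rightarrow> nat set \<Rightarrow> 'a option" where
  "set_product mul f H = list_product mul (map f (sorted_list_of_set H))"

definition adequate_seqs :: "'a set \<Rightarrow> ('a \<Rightarrow> 'a \<Rightarrow> 'a option) \<Rightarrow> (nat \<Rightarrow> 'a) set" where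
  "adequate_seqs S mul =
     {f \<in> {1..} \<rightarrow>\<^sub>E S.
        (\<forall>H \<in> fin_subsets {1..}. set_product mul f H \<noteq> None) \<and>
        (\<forall>F \<in> fin_subsets S. \<exists>m\<ge>1. \<forall>H \<in> fin_subsets {1..}. Min H \<ge> m \<longrightarrow>
           (\<exists>x \<in> sigma S mul F. set_product mul f H = Some x))}"

text \<open>\<open>a(1) * f(t(1)) * a(2) * \<dots> * a(m) * f(t(m)) * a(m+1)\<close>\<close>

definition alt_product ::
  "('a \<Rightarrow> 'a \<Rightarrow> 'a option) \<Rightarrow> nat \<Rightarrow> (nat \<Rightarrow> 'a) \<Rightarrow> (nat \<Rightarrow> nat) \<Rightarrow> (nat \<Rightarrow> 'a) \<Rightarrow> 'a option" where
  "alt_product mul m a t f =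
     list_product mul (concat (map (\<lambda>i. [a i, f (t i)]) [1..<m+1]) @ [a (m+1)])"

definition k_CR_set :: "'a set \<Rightarrow> ('a \<Rightarrow> 'a \<Rightarrow> 'a option) \<Rightarrow> nat \<Rightarrow> 'a set \<Rightarrow> bool" where
  "k_CR_set S mul k A \<longleftrightarrow>
     A \<subseteq> S \<and>
     (\<forall>L \<in> fin_subsets S. \<exists>r\<ge>1. \<forall>F \<in> fin_subsets_le (adequate_seqs S mul) k.
        \<exists>m\<ge>1. \<exists>a \<in> {1..m+1} \<rightarrow>\<^sub>E S. \<exists>t \<in> {1..m} \<rightarrow>\<^sub>E {1..r}.
          strict_mono_on {1..m} t \<and>
          (\<forall>f\<in>F. \<exists>x \<in> A \<inter> sigma S mul L. alt_product mul m a t f = Some x))"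

definition CR_set :: "'a set \<Rightarrow> ('a \<Rightarrow> 'a \<Rightarrow> 'a option) \<Rightarrow> 'a set \<Rightarrow> bool" where
  "CR_set S mul A \<longleftrightarrow> (\<forall>k\<ge>1. k_CR_set S mul k A)"

definition property_dagger :: "'a set \<Rightarrow> ('a \<Rightarrow> 'a \<Rightarrow> 'a option) \<Rightarrow> bool" where
  "property_dagger S mul \<longleftrightarrow>
     (\<forall>k\<ge>1. \<forall>L \<in> fin_subsets S. \<exists>r\<ge>1. \<forall>F \<in> fin_subsets_le (adequate_seqs S mul) k.
        \<exists>t\<in>{1..r}. \<forall>f\<in>F. f t \<in> sigma S mul L)"

end

theory Submission
  imports Defs
begin

text \<open>
  One alternation suffices: \<open>m = 1\<close>. Pick \<open>a(1)\<close> in \<open>\<sigma>(L)\<close>. Property (dagger), applied to the finite set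
  of \<open>a(1)\<close> and all \<open>l * a(1)\<close> with \<open>l \<in> L\<close>, yields \<open>t\<close> bounded independently of \<open>F\<close> such that
  \<open>a(1) * f(t) \<in> \<sigma>(L)\<close> for all \<open>f \<in> F\<close>. As \<open>F\<close> is finite and \<open>a(2)\<close> may depend on \<open>F\<close>, adequacy
  gives an \<open>a(2)\<close> that keeps all these products in \<open>\<sigma>(L)\<close>.
\<close>

text \<open>\<open>the\<close> is harmless for \<open>a\<close> in \<sigma>(\<open>L\<close>), where
  every \<open>mul l a\<close> is defined. Inserting \<open>a\<close> itself forces
  \<open>mul a b\<close> to be defined for \<open>b\<close> in \<sigma> of this set.\<close>

definition left_factors :: "('a \<Rightarrow> 'a \<Rightarrow> 'a option) \<Rightarrow> 'a set \<Rightarrow> 'a \<Rightarrow> 'a set" where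
  "left_factors mul L a = insert a ((\<lambda>l. the (mul l a)) ` L)"

lemma partial_semigroup_closed:
  assumes "partial_semigroup S mul" and "mul x y = Some z"
  shows "x \<in> S" "y \<in> S" "z \<in> S"
  using assms unfolding partial_semigroup_def by blast+

lemma sigma_UN: "sigma S mul (\<Union>i\<in>I. G i) = (\<Inter>i\<in>I. sigma S mul (G i))"
  by (auto simp: sigma_def)

text \<open>Nonemptiness of \<open>F\<close> matters: the intersection over the empty set would be
  the whole type.\<close>

lemma sigma_subset: "F \<in> fin_subsets X \<Longrightarrow> sigma S mul F \<subseteq> S"
  by (auto simp: fin_subsets_def sigma_def phi_def)

lemma left_factors_fin_subsets:
  assumes "partial_semigroup S mul" and "L \<in> fin_subsets S" and "a \<in> sigma S mul L"
  shows "left_factors mul L a \<in> fin_subsets S"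
proof -
  have "a \<in> S"
    using subsetD[OF sigma_subset[OF assms(2)] assms(3)] .
  moreover have "the (mul l a) \<in> S" if "l \<in> L" for l
    using that assms(3) partial_semigroup_closed(3)[OF assms(1)]
    by (fastforce simp: sigma_def phi_def)
  ultimately show ?thesis
    using assms(2) by (auto simp: fin_subsets_def left_factors_def)
qed

text \<open>For \<open>l\<close> in \<open>L\<close>, the element \<open>l * a\<close> is a left
  factor, so \<open>(l * a) * b\<close> is defined, and associativity carries this over to
  \<open>l * (a * b)\<close>. Both multiplications in the theorem are controlled this way.\<close>

lemma mul_in_sigma:
  assumes S: "partial_semigroup S mul" and L: "L \<subseteq> S"
    and a: "a \<in> sigma S mul L" and b: "b \<in> sigma S mul (left_factors mul L a)"
  obtains c where "mul a b = Some c" and "c \<in> sigma S mul L"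
proof -
  obtain c where c: "mul a b = Some c"
    using b by (auto simp: sigma_def phi_def left_factors_def)
  note abc = partial_semigroup_closed[OF S c]
  have "mul l c \<noteq> None" if l: "l \<in> L" for l
  proof -
    obtain u where u: "mul l a = Some u"
      using a l by (auto simp: sigma_def phi_def)
    have "mul u b \<noteq> None"
      using b l u by (auto simp: sigma_def phi_def left_factors_def)
    moreover have "Option.bind (mul l a) (\<lambda>u. mul u b) = Option.bind (mul a b) (mul l)"
      using S L l abc unfolding partial_semigroup_def by blast
    ultimately show ?thesis
      using u c by simp
  qed
  then show thesis
    using that c abc by (auto simp: sigma_def phi_def)
qed

theorem theorem3p2:
  fixes S :: "'a set" and mul :: "'a \<Rightarrow> 'a \<Rightarrow> 'a option"
  assumes "partial_semigroup S mul"
    and "adequate S mul"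
    and "property_dagger S mul"
  shows "CR_set S mul S"
  unfolding CR_set_def k_CR_set_def
proof (intro allI impI conjI ballI)
  fix k :: nat and L assume k: "k \<ge> 1" and L: "L \<in> fin_subsets S"
  have LS: "L \<subseteq> S"
    using L by (simp add: fin_subsets_def)
  obtain a1 where a1: "a1 \<in> sigma S mul L"
    using assms(2) L by (auto simp: adequate_def)
  obtain r where r: "r \<ge> 1"
    and dagger: "\<And>F. F \<in> fin_subsets_le (adequate_seqs S mul) k \<Longrightarrow>
      \<exists>t\<in>{1..r}. \<forall>f\<in>F. f t \<in> sigma S mul (left_factors mul L a1)"
    using assms(3)[unfolded property_dagger_def, rule_format, OF k
        left_factors_fin_subsets[OF assms(1) L a1]] by auto
  show "\<exists>r\<ge>1. \<forall>F \<in> fin_subsets_le (adequate_seqs S mul) k.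
        \<exists>m\<ge>1. \<exists>a \<in> {1..m+1} \<rightarrow>\<^sub>E S. \<exists>t \<in> {1..m} \<rightarrow>\<^sub>E {1..r}.
          strict_mono_on {1..m} t \<and>
          (\<forall>f\<in>F. \<exists>x \<in> S \<inter> sigma S mul L. alt_product mul m a t f = Some x)"
  proof (rule exI[of _ r], intro conjI r ballI)
    fix F assume F: "F \<in> fin_subsets_le (adequate_seqs S mul) k"
    then obtain s where s: "s \<in> {1..r}"
      and fs: "\<And>f. f \<in> F \<Longrightarrow> f s \<in> sigma S mul (left_factors mul L a1)"
      using dagger by blast
    have "\<exists>c. mul a1 (f s) = Some c \<and> c \<in> sigma S mul L" if "f \<in> F" for f
      using mul_in_sigma[OF assms(1) LS a1 fs[OF that]] by blast
    \<comment> \<open>\<open>c f\<close> is the partial product \<open>a1 * f(s)\<close>. It varies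
      with \<open>f\<close>, whereas \<open>a2\<close> has to be common to all of
      \<open>F\<close>.\<close>
    then obtain c where c: "\<And>f. f \<in> F \<Longrightarrow> mul a1 (f s) = Some (c f)"
      and cL: "\<And>f. f \<in> F \<Longrightarrow> c f \<in> sigma S mul L"
      by metis
    have "finite F" "F \<noteq> {}"
      using F by (simp_all add: fin_subsets_le_def fin_subsets_def)
    moreover have "left_factors mul L (c f) \<in> fin_subsets S" if "f \<in> F" for f
      using left_factors_fin_subsets[OF assms(1) L cL[OF that]] .
    ultimately have U: "(\<Union>f\<in>F. left_factors mul L (c f)) \<in> fin_subsets S"
      unfolding fin_subsets_def by blast
    \<comment> \<open>Adequacy needs a finite nonempty set; the union over \<open>F\<close> is one
      because \<open>F\<close> is finite and nonempty.\<close>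
    then obtain a2 where a2: "a2 \<in> sigma S mul (\<Union>f\<in>F. left_factors mul L (c f))"
      using assms(2) by (auto simp only: adequate_def)
    have a2S: "a2 \<in> S"
      using subsetD[OF sigma_subset[OF U] a2] .
    have a1S: "a1 \<in> S"
      using subsetD[OF sigma_subset[OF L] a1] .
    \<comment> \<open>The restricted abstractions make the witnesses extensional, as
      \<open>\<rightarrow>\<^sub>E\<close> demands.\<close>
    define a where "a = (\<lambda>i\<in>{1..1+1::nat}. if i = 1 then a1 else a2)"
    define t where "t = (\<lambda>i\<in>{1..1::nat}. s)"
    have "\<exists>x \<in> S \<inter> sigma S mul L. alt_product mul 1 a t f = Some x" if f: "f \<in> F" for f
    proof -
      have "a2 \<in> sigma S mul (left_factors mul L (c f))"
        using a2 f by (simp add: sigma_UN)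
      then obtain x where x: "mul (c f) a2 = Some x" "x \<in> sigma S mul L"
        using mul_in_sigma[OF assms(1) LS cL[OF f]] by blast
      \<comment> \<open>\<open>list_product\<close> brackets to the left, so this is literally
        \<open>(a1 * f(s)) * a2 = c f * a2\<close>.\<close>
      then have "alt_product mul 1 a t f = Some x"
        using c[OF f] by (simp add: alt_product_def a_def t_def)
      then show ?thesis
        using x partial_semigroup_closed(3)[OF assms(1) x(1)] by blast
    qed
    moreover have "a \<in> {1..1+1} \<rightarrow>\<^sub>E S" "t \<in> {1..1} \<rightarrow>\<^sub>E {1..r}"
      using a1S a2S s by (auto simp: a_def t_def)
    moreover have "strict_mono_on {1..1} t"
      by (simp add: strict_mono_on_def)
    ultimately show "\<exists>m\<ge>1. \<exists>a \<in> {1..m+1} \<rightarrow>\<^sub>E S. \<exists>t \<in> {1..m} \<rightarrow>\<^sub>E {1..r}.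
          strict_mono_on {1..m} t \<and>
          (\<forall>f\<in>F. \<exists>x \<in> S \<inter> sigma S mul L. alt_product mul m a t f = Some x)"
      by - (intro exI[of _ 1] conjI bexI[of _ a] bexI[of _ t] ballI; simp)
  qed
qed simp

end
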